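(* Let $A$ be a Banach algebra and $I:A\to A$ the identity mapping. If $A^{**}$ has the $I$-$w^*w$ property and $A^{**}$ is weakly amenable, then $A$ is weakly amenable.
   Context: $A^{**}$ is a Banach algebra under the first Arens product: $\langle b''a',a\rangle=\langle b'',a'a\rangle$ and $\langle a''b'',a'\rangle=\langle a'',b''a'\rangle$, where $\langle a'a,b\rangle=\langle a',ab\rangle$ ($a,b\in A$, $a'\in A^*$, $a'',b''\in A^{**}$). $A^{**}$ has the $I$-$w^*w$ property if for every $a''\in A^{**}$ the map $b''\mapsto a''b''$, $A^{**}\to A^{**}$, is weak$^*$-to-weak continuous. A Banach algebra $B$ is weakly amenable if every derivation (bounded linear $D:B\to B^*$ with $D(xy)=xD(y)+D(x)y$) is inner, i.e. of the form $a\mapsto ax-xa$ for some $x\in B^*$, where $B^*$ has the dual bimodule actions $\langle a'a,b\rangle=\langle a',ab\rangle$, $\langle aa',b\rangle=\langle a',ba\rangle$. *)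

theory Defs
  imports "HOL-Analysis.Analysis" "HOL-Library.Function_Algebras"
begin

text \<open>
  Real and complex Banach algebras are treated uniformly. The scalars form a type of class
  \<open>real_normed_field\<close>; by the Gelfand--Mazur theorem such a field is \<open>\<real>\<close> or \<open>\<complex>\<close>. The algebra is not
  assumed to be unital.
\<close>

locale banach_algebra_over = vector_space sc
  for sc :: "'k::real_normed_field \<Rightarrow> 'a::{real_normed_algebra, banach} \<Rightarrow> 'a" +
  assumes scale_of_real: "sc (of_real r) x = r *\<^sub>R x"
    and norm_scale: "norm (sc c x) = norm c * norm x"
    and scale_mult_left: "sc c x * y = sc c (x * y)"
    and scale_mult_right: "x * sc c y = sc c (x * y)"

lemma banach_algebra_over_real:
  "banach_algebra_over (scaleR :: real \<Rightarrow> 'a::{real_normed_algebra, banach} \<Rightarrow> 'a)"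
  by unfold_locales (simp_all add: scaleR_add_right scaleR_add_left)

lemma banach_algebra_over_complex: "banach_algebra_over ((*) :: complex \<Rightarrow> complex \<Rightarrow> complex)"
  by unfold_locales (simp_all add: algebra_simps norm_mult scaleR_conv_of_real)

text \<open>
  The dual depends on the scalar action, which is a term, so dual spaces are sets rather than types.
  Addition is that of the ambient type (pointwise on functions). Functionals on a space with carrier
  \<open>V\<close> are total functions vanishing outside \<open>V\<close>, so that equality of functionals is equality of
  functions.
\<close>

record ('k, 'v) normed_sp =
  vecs :: "'v set"
  smult :: "'k \<Rightarrow> 'v \<Rightarrow> 'v"
  nrm :: "'v \<Rightarrow> real"

record ('k, 'v) normed_alg = "('k, 'v) normed_sp" +
  mul :: "'v \<Rightarrow> 'v \<Rightarrow> 'v"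

definition alg_of ::
  "('k::real_normed_field \<Rightarrow> 'a::{real_normed_algebra, banach} \<Rightarrow> 'a) \<Rightarrow> ('k, 'a) normed_alg" where
  "alg_of sc = \<lparr>vecs = UNIV, smult = sc, nrm = norm, mul = (*)\<rparr>"

definition dual ::
  "('k::real_normed_field, 'v::ab_group_add, 'm) normed_sp_scheme \<Rightarrow> ('k, 'v \<Rightarrow> 'k) normed_sp" where
  "dual V = \<lparr>
     vecs = {f. (\<forall>x. x \<notin> vecs V \<longrightarrow> f x = 0) \<and>
                (\<forall>x\<in>vecs V. \<forall>y\<in>vecs V. f (x + y) = f x + f y) \<and>
                (\<forall>c. \<forall>x\<in>vecs V. f (smult V c x) = c * f x) \<and>
                (\<exists>K. \<forall>x\<in>vecs V. norm (f x) \<le> K * nrm V x)},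
     smult = (\<lambda>c f x. c * f x),
     nrm = (\<lambda>f. SUP x\<in>{x \<in> vecs V. nrm V x \<le> 1}. norm (f x))\<rparr>"

definition initial_topology :: "'v set \<Rightarrow> ('v \<Rightarrow> 'k::topological_space) set \<Rightarrow> 'v topology" where
  "initial_topology V F = topology_generated_by {{x \<in> V. g x \<in> U} | g U. g \<in> F \<and> open U}"

definition weak_topology ::
  "('k::real_normed_field, 'v::ab_group_add, 'm) normed_sp_scheme \<Rightarrow> 'v topology" where
  "weak_topology V = initial_topology (vecs V) (vecs (dual V))"

text \<open>The weak* topology on the dual of \<open>V\<close>.\<close>

definition weak_star_topology ::
  "('k::real_normed_field, 'v::ab_group_add, 'm) normed_sp_scheme \<Rightarrow> ('v \<Rightarrow> 'k) topology" where
  "weak_star_topology V = initial_topology (vecs (dual V)) ((\<lambda>x f. f x) ` vecs V)"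

text \<open>The dual bimodule actions: \<open>\<langle>fa, b\<rangle> = \<langle>f, ab\<rangle>\<close> and \<open>\<langle>af, b\<rangle> = \<langle>f, ba\<rangle>\<close>.\<close>

definition dual_ract ::
  "('k::real_normed_field, 'v::ab_group_add) normed_alg \<Rightarrow> ('v \<Rightarrow> 'k) \<Rightarrow> 'v \<Rightarrow> ('v \<Rightarrow> 'k)" where
  "dual_ract B f a = (\<lambda>b. if b \<in> vecs B then f (mul B a b) else 0)"

definition dual_lact ::
  "('k::real_normed_field, 'v::ab_group_add) normed_alg \<Rightarrow> 'v \<Rightarrow> ('v \<Rightarrow> 'k) \<Rightarrow> ('v \<Rightarrow> 'k)" where
  "dual_lact B a f = (\<lambda>b. if b \<in> vecs B then f (mul B b a) else 0)"

text \<open>The functional \<open>b''a'\<close>, given by \<open>\<langle>b''a', a\<rangle> = \<langle>b'', a'a\<rangle>\<close>.\<close>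

definition bidual_act ::
  "('k::real_normed_field, 'v::ab_group_add) normed_alg
    \<Rightarrow> (('v \<Rightarrow> 'k) \<Rightarrow> 'k) \<Rightarrow> ('v \<Rightarrow> 'k) \<Rightarrow> ('v \<Rightarrow> 'k)" where
  "bidual_act A b f = (\<lambda>a. if a \<in> vecs A then b (dual_ract A f a) else 0)"

definition first_arens ::
  "('k::real_normed_field, 'v::ab_group_add) normed_alg
    \<Rightarrow> (('v \<Rightarrow> 'k) \<Rightarrow> 'k) \<Rightarrow> (('v \<Rightarrow> 'k) \<Rightarrow> 'k) \<Rightarrow> (('v \<Rightarrow> 'k) \<Rightarrow> 'k)" where
  "first_arens A a b = (\<lambda>f. if f \<in> vecs (dual A) then a (bidual_act A b f) else 0)"

definition bidual_alg ::
  "('k::real_normed_field, 'v::ab_group_add) normed_alg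
    \<Rightarrow> ('k, ('v \<Rightarrow> 'k) \<Rightarrow> 'k) normed_alg" where
  "bidual_alg A = \<lparr>vecs = vecs (dual (dual A)), smult = smult (dual (dual A)),
     nrm = nrm (dual (dual A)), mul = first_arens A\<rparr>"

definition I_wsw_property ::
  "('k::real_normed_field, 'v::ab_group_add) normed_alg \<Rightarrow> bool" where
  "I_wsw_property A \<longleftrightarrow>
     (\<forall>a\<in>vecs (bidual_alg A).
        continuous_map (weak_star_topology (dual A)) (weak_topology (bidual_alg A))
          (\<lambda>b. mul (bidual_alg A) a b))"

definition derivation ::
  "('k::real_normed_field, 'v::ab_group_add) normed_alg \<Rightarrow> ('v \<Rightarrow> ('v \<Rightarrow> 'k)) \<Rightarrow> bool" where
  "derivation B D \<longleftrightarrow>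
     (\<forall>x\<in>vecs B. D x \<in> vecs (dual B)) \<and>
     (\<forall>x\<in>vecs B. \<forall>y\<in>vecs B. D (x + y) = D x + D y) \<and>
     (\<forall>c. \<forall>x\<in>vecs B. D (smult B c x) = smult (dual B) c (D x)) \<and>
     (\<exists>K. \<forall>x\<in>vecs B. nrm (dual B) (D x) \<le> K * nrm B x) \<and>
     (\<forall>x\<in>vecs B. \<forall>y\<in>vecs B. D (mul B x y) = dual_lact B x (D y) + dual_ract B (D x) y)"

definition inner_derivation ::
  "('k::real_normed_field, 'v::ab_group_add) normed_alg \<Rightarrow> ('v \<Rightarrow> ('v \<Rightarrow> 'k)) \<Rightarrow> bool" where
  "inner_derivation B D \<longleftrightarrow>
     (\<exists>f\<in>vecs (dual B). \<forall>a\<in>vecs B. D a = dual_lact B a f - dual_ract B f a)"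

definition weakly_amenable ::
  "('k::real_normed_field, 'v::ab_group_add) normed_alg \<Rightarrow> bool" where
  "weakly_amenable B \<longleftrightarrow> (\<forall>D. derivation B D \<longrightarrow> inner_derivation B D)"

end

theory Submission
  imports Defs
begin

text \<open>
  Let \<open>D : A \<rightarrow> A*\<close> be a derivation and \<open>D'' : A** \<rightarrow> A***\<close> its second adjoint. Two facts give the
  theorem. First, \<open>D''\<close> is again a derivation. Second, if \<open>D''\<close> is implemented by \<open>g \<in> A***\<close>, then
  \<open>D\<close> is implemented by the restriction of \<open>g\<close> to \<open>A \<subseteq> A**\<close>, because \<open>D''\<close> extends \<open>D\<close> and the
  first Arens product extends the product of \<open>A\<close>.

  For the first fact, fix \<open>b\<close> and \<open>c\<close> in \<open>A**\<close> and compare both sides of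
  \<open>\<langle>D''(ab), c\<rangle> = \<langle>D''b, ca\<rangle> + \<langle>D''a, bc\<rangle>\<close>
  as functions of \<open>a \<in> A**\<close>. If all three terms are weak* continuous in \<open>a\<close>, each is evaluation of
  \<open>a\<close> at an element of \<open>A*\<close> (\<open>weak_star_continuous_imp_evaluation\<close>), so the identity has to be
  checked for \<open>a \<in> A\<close> only. There every term is visibly an evaluation of \<open>b\<close>, which reduces the
  identity to \<open>b \<in> A\<close>, where it is the derivation rule of \<open>D\<close> tested against \<open>c\<close>
  (\<open>second_adjoint_mult_to_bidual\<close>). The first and the last term are always weak* continuous in \<open>a\<close>. The
  middle one applies the functional \<open>D''b\<close> to \<open>ca\<close>, and its weak* continuity is what the
  \<open>I\<close>-\<open>w*w\<close> property provides. Passing to representing elements of \<open>A*\<close> replaces the usual iterated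
  limits along nets from \<open>A\<close>.
\<close>

section \<open>Duals of seminormed spaces given by carriers\<close>

text \<open>
  Only what makes dual norms behave is required, so that \<open>A\<close>, \<open>A*\<close> and \<open>A**\<close> are all instances:
  sub-homogeneity suffices for rescaling to the unit ball.
\<close>

locale seminormed_carrier =
  fixes V :: "('k::real_normed_field, 'v::ab_group_add, 'm) normed_sp_scheme"
  assumes zero_mem: "0 \<in> vecs V"
    and add_mem: "x \<in> vecs V \<Longrightarrow> y \<in> vecs V \<Longrightarrow> x + y \<in> vecs V"
    and smult_mem: "x \<in> vecs V \<Longrightarrow> smult V c x \<in> vecs V"
    and nrm_nonneg: "x \<in> vecs V \<Longrightarrow> 0 \<le> nrm V x"
    and nrm_smult_le: "x \<in> vecs V \<Longrightarrow> nrm V (smult V c x) \<le> norm c * nrm V x"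

lemma dual_memI:
  assumes "\<And>x. x \<notin> vecs V \<Longrightarrow> f x = 0"
    and "\<And>x y. x \<in> vecs V \<Longrightarrow> y \<in> vecs V \<Longrightarrow> f (x + y) = f x + f y"
    and "\<And>c x. x \<in> vecs V \<Longrightarrow> f (smult V c x) = c * f x"
    and "\<And>x. x \<in> vecs V \<Longrightarrow> norm (f x) \<le> K * nrm V x"
  shows "f \<in> vecs (dual V)"
  using assms by (simp add: dual_def) blast

lemma
  assumes "f \<in> vecs (dual V)"
  shows dual_outside: "x \<notin> vecs V \<Longrightarrow> f x = 0"
    and dual_add: "x \<in> vecs V \<Longrightarrow> y \<in> vecs V \<Longrightarrow> f (x + y) = f x + f y"
    and dual_smult: "x \<in> vecs V \<Longrightarrow> f (smult V c x) = c * f x"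
    and dual_bounded: "\<exists>K. \<forall>x\<in>vecs V. norm (f x) \<le> K * nrm V x"
  using assms by (simp_all add: dual_def)

lemma smult_dual: "smult (dual V) c f = (\<lambda>x. c * f x)"
  by (simp add: dual_def)

context seminormed_carrier
begin

lemma dual_zero: "f \<in> vecs (dual V) \<Longrightarrow> f 0 = 0"
  using dual_add[of f V 0 0] zero_mem by simp

lemma dual_nrm_le:
  assumes "0 \<le> K" and "\<And>x. x \<in> vecs V \<Longrightarrow> norm (f x) \<le> K * nrm V x"
  shows "nrm (dual V) f \<le> K"
proof -
  have "nrm V (smult V 0 0) \<le> 1"
    using nrm_smult_le[OF zero_mem, of 0] by simp
  then have "smult V 0 0 \<in> {x \<in> vecs V. nrm V x \<le> 1}"
    using smult_mem[OF zero_mem] by simp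
  then have ne: "{x \<in> vecs V. nrm V x \<le> 1} \<noteq> {}"
    by blast
  have "norm (f x) \<le> K" if "x \<in> vecs V" "nrm V x \<le> 1" for x
    using assms(2)[OF that(1)] mult_left_mono[OF that(2) assms(1)] by simp
  then show ?thesis
    unfolding dual_def using ne by (auto intro!: cSUP_least)
qed

lemma norm_le_dual_nrm_unit:
  assumes f: "f \<in> vecs (dual V)" and x: "x \<in> vecs V" "nrm V x \<le> 1"
  shows "norm (f x) \<le> nrm (dual V) f"
proof -
  obtain K where K: "\<And>x. x \<in> vecs V \<Longrightarrow> norm (f x) \<le> K * nrm V x"
    using dual_bounded[OF f] by blast
  have "norm (f y) \<le> \<bar>K\<bar>" if "y \<in> vecs V" "nrm V y \<le> 1" for y
  proof -
    have "K * nrm V y \<le> \<bar>K\<bar> * 1"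
      using that nrm_nonneg by (intro mult_mono) auto
    then show ?thesis
      using K[OF that(1)] by simp
  qed
  then have "bdd_above ((\<lambda>x. norm (f x)) ` {x \<in> vecs V. nrm V x \<le> 1})"
    by (auto intro!: bdd_aboveI)
  then show ?thesis
    using x by (auto simp: dual_def intro: cSUP_upper)
qed

lemma norm_le_dual_nrm:
  assumes f: "f \<in> vecs (dual V)" and x: "x \<in> vecs V"
  shows "norm (f x) \<le> nrm (dual V) f * nrm V x"
proof (cases "nrm V x = 0")
  case True
  then show ?thesis
    using dual_bounded[OF f] x by force
next
  case False
  with nrm_nonneg[OF x] have pos: "0 < nrm V x"
    by simp
  define c :: 'k where "c = of_real (1 / nrm V x)"
  have c: "norm c * nrm V x = 1"
    using pos by (simp add: c_def norm_divide)
  have "norm (f (smult V c x)) \<le> nrm (dual V) f"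
    using norm_le_dual_nrm_unit[OF f smult_mem[OF x]] nrm_smult_le[OF x, of c] c by simp
  then have "norm c * norm (f x) \<le> nrm (dual V) f"
    by (simp add: dual_smult[OF f x] norm_mult)
  then have "(norm c * norm (f x)) * nrm V x \<le> nrm (dual V) f * nrm V x"
    using pos by (intro mult_right_mono) auto
  moreover have "(norm c * norm (f x)) * nrm V x = norm (f x)"
    using c by (simp add: mult.commute mult.left_commute)
  ultimately show ?thesis
    by simp
qed

lemma dual_nrm_nonneg:
  assumes "f \<in> vecs (dual V)"
  shows "0 \<le> nrm (dual V) f"
proof -
  have "nrm V (smult V 0 0) \<le> 1"
    using nrm_smult_le[OF zero_mem, of 0] by simp
  from norm_le_dual_nrm_unit[OF assms smult_mem[OF zero_mem] this] show ?thesis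
    using norm_ge_zero order_trans by blast
qed

lemma dual_add_mem:
  assumes f: "f \<in> vecs (dual V)" and g: "g \<in> vecs (dual V)"
  shows "f + g \<in> vecs (dual V)"
proof (rule dual_memI[where K = "nrm (dual V) f + nrm (dual V) g"])
  fix x assume x: "x \<in> vecs V"
  have "norm ((f + g) x) \<le> norm (f x) + norm (g x)"
    by (simp add: norm_triangle_ineq)
  also have "\<dots> \<le> (nrm (dual V) f + nrm (dual V) g) * nrm V x"
    using norm_le_dual_nrm[OF f x] norm_le_dual_nrm[OF g x] by (simp add: algebra_simps)
  finally show "norm ((f + g) x) \<le> (nrm (dual V) f + nrm (dual V) g) * nrm V x" .
qed (simp_all add: dual_outside[OF f] dual_outside[OF g] dual_add[OF f] dual_add[OF g]
       dual_smult[OF f] dual_smult[OF g] algebra_simps)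

lemma norm_smult_dual_le:
  assumes f: "f \<in> vecs (dual V)" and x: "x \<in> vecs V"
  shows "norm (smult (dual V) c f x) \<le> (norm c * nrm (dual V) f) * nrm V x"
  using mult_left_mono[OF norm_le_dual_nrm[OF f x] norm_ge_zero[of c]]
  by (simp add: smult_dual norm_mult mult.assoc)

lemma dual_smult_mem:
  assumes f: "f \<in> vecs (dual V)"
  shows "smult (dual V) c f \<in> vecs (dual V)"
  by (rule dual_memI[OF _ _ _ norm_smult_dual_le[OF f]])
    (simp_all add: smult_dual dual_outside[OF f] dual_add[OF f] dual_smult[OF f] algebra_simps)

lemma seminormed_carrier_dual: "seminormed_carrier (dual V)"
proof
  show "0 \<in> vecs (dual V)"
    by (rule dual_memI[where K = 0]) simp_all
  show "nrm (dual V) (smult (dual V) c f) \<le> norm c * nrm (dual V) f"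
    if f: "f \<in> vecs (dual V)" for c f
    by (rule dual_nrm_le[OF _ norm_smult_dual_le[OF f]]) (simp add: dual_nrm_nonneg[OF f])
qed (auto intro: dual_add_mem dual_smult_mem dual_nrm_nonneg)

end


section \<open>Weak* continuous linear functionals are evaluations\<close>

lemma topspace_initial_topology:
  assumes "F \<noteq> {}"
  shows "topspace (initial_topology V F) = V"
proof -
  obtain g where g: "g \<in> F"
    using assms by blast
  have "V = {x \<in> V. g x \<in> UNIV}"
    by simp
  then have "V \<in> {{x \<in> V. g x \<in> U} | g U. g \<in> F \<and> open U}"
    using g open_UNIV by blast
  then show ?thesis
    unfolding initial_topology_def topology_generated_by_topspace by blast
qed

lemma continuous_map_initial_topology:
  assumes "g \<in> F"
  shows "continuous_map (initial_topology V F) euclidean g"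
proof -
  have top: "topspace (initial_topology V F) = V"
    using assms by (intro topspace_initial_topology) blast
  have "openin (initial_topology V F) {x \<in> V. g x \<in> U}" if "open U" for U
    unfolding initial_topology_def using assms that by (intro topology_generated_by_Basis) blast
  then show ?thesis
    by (auto simp: continuous_map_def top)
qed

context seminormed_carrier
begin

lemma weak_star_open_contains_annihilator:
  assumes "openin (weak_star_topology V) U" and "0 \<in> U"
  shows "\<exists>F. finite F \<and> F \<subseteq> vecs V \<and> {f \<in> vecs (dual V). \<forall>x\<in>F. f x = 0} \<subseteq> U"
proof -
  let ?S = "{{f \<in> vecs (dual V). g f \<in> U} | g U. g \<in> (\<lambda>x f. f x) ` vecs V \<and> open U}"
  have "generate_topology_on ?S U"
    using assms(1) unfolding weak_star_topology_def initial_topology_def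
    by (simp add: openin_topology_generated_by_iff)
  then show ?thesis
    using assms(2)
  proof (induction rule: generate_topology_on.induct)
    case Empty
    then show ?case by simp
  next
    case (Int a b)
    then obtain F G where "finite F" "F \<subseteq> vecs V" "{f \<in> vecs (dual V). \<forall>x\<in>F. f x = 0} \<subseteq> a"
      and "finite G" "G \<subseteq> vecs V" "{f \<in> vecs (dual V). \<forall>x\<in>G. f x = 0} \<subseteq> b"
      by blast
    then show ?case
      by (intro exI[of _ "F \<union> G"]) blast
  next
    case (UN K)
    then show ?case by (meson Union_iff Union_upper subset_trans)
  next
    case (Basis s)
    then obtain x U where x: "x \<in> vecs V" and s: "s = {f \<in> vecs (dual V). f x \<in> U}"
      by blast
    from Basis.prems have "0 \<in> U"
      unfolding s by simp
    then have "{f \<in> vecs (dual V). \<forall>y\<in>{x}. f y = 0} \<subseteq> s"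
      unfolding s by auto
    with x show ?case
      by (intro exI[of _ "{x}"] conjI) simp_all
  qed
qed

text \<open>
  Induction on the finite set: if some \<open>e\<close> annihilates \<open>F\<close> but not \<open>x\<close>, subtracting a multiple of
  evaluation at \<open>x\<close> makes \<open>\<phi>\<close> vanish at \<open>e\<close> and hence on the whole annihilator of \<open>F\<close>, as this
  is spanned by \<open>e\<close> and the annihilator of \<open>insert x F\<close>.
\<close>

lemma functional_vanishing_on_annihilator:
  assumes "finite F" and "F \<subseteq> vecs V"
    and "\<And>f g. f \<in> vecs (dual V) \<Longrightarrow> g \<in> vecs (dual V) \<Longrightarrow> \<phi> (f + g) = \<phi> f + \<phi> g"
    and "\<And>c f. f \<in> vecs (dual V) \<Longrightarrow> \<phi> (smult (dual V) c f) = c * \<phi> f"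
    and "\<And>f. f \<in> vecs (dual V) \<Longrightarrow> \<forall>x\<in>F. f x = 0 \<Longrightarrow> \<phi> f = 0"
  shows "\<exists>h\<in>vecs V. \<forall>f\<in>vecs (dual V). \<phi> f = f h"
  using assms
proof (induction F arbitrary: \<phi> rule: finite_induct)
  case empty
  then show ?case
    using zero_mem dual_zero by (intro bexI[of _ 0]) auto
next
  case (insert x F)
  note smult = insert.prems(3) and van = insert.prems(4)
  have add: "\<phi> (f + g) = \<phi> f + \<phi> g" if "f \<in> vecs (dual V)" "g \<in> vecs (dual V)" for f g
    by (rule insert.prems(2)[OF that])
  have x: "x \<in> vecs V" and F: "F \<subseteq> vecs V"
    using insert.prems(1) by auto
  show ?case
  proof (cases "\<exists>e\<in>vecs (dual V). (\<forall>y\<in>F. e y = 0) \<and> e x \<noteq> 0")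
    case True
    then obtain e where e: "e \<in> vecs (dual V)" "\<forall>y\<in>F. e y = 0" "e x \<noteq> 0"
      by blast
    define t where "t = \<phi> e / e x"
    have "\<exists>h\<in>vecs V. \<forall>f\<in>vecs (dual V). \<phi> f - t * f x = f h"
    proof (rule insert.IH[OF F])
      fix f assume f: "f \<in> vecs (dual V)" "\<forall>y\<in>F. f y = 0"
      let ?c = "- (f x / e x)"
      have mem: "smult (dual V) ?c e \<in> vecs (dual V)"
        using dual_smult_mem e(1) by blast
      have "\<phi> (f + smult (dual V) ?c e) = 0"
        using e f by (intro van dual_add_mem mem) (auto simp: smult_dual)
      then have "\<phi> f + ?c * \<phi> e = 0"
        using add[OF f(1) mem] smult[OF e(1)] by simp
      then show "\<phi> f - t * f x = 0"
        by (simp add: t_def mult.commute)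
    next
      fix f g assume "f \<in> vecs (dual V)" "g \<in> vecs (dual V)"
      from add[OF this] show "\<phi> (f + g) - t * (f + g) x = \<phi> f - t * f x + (\<phi> g - t * g x)"
        by (simp add: algebra_simps)
    next
      fix c f assume "f \<in> vecs (dual V)"
      from smult[OF this] show "\<phi> (smult (dual V) c f) - t * smult (dual V) c f x = c * (\<phi> f - t * f x)"
        by (simp only: smult_dual) (simp add: algebra_simps)
    qed
    then obtain h where h: "h \<in> vecs V" "\<And>f. f \<in> vecs (dual V) \<Longrightarrow> \<phi> f - t * f x = f h"
      by blast
    have "\<phi> f = f (h + smult V t x)" if f: "f \<in> vecs (dual V)" for f
      using h(2)[OF f] by (simp add: dual_add[OF f h(1) smult_mem[OF x]] dual_smult[OF f x] algebra_simps)
    then show ?thesis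
      using add_mem[OF h(1) smult_mem[OF x]] by blast
  next
    case False
    then have "\<phi> f = 0" if "f \<in> vecs (dual V)" "\<forall>y\<in>F. f y = 0" for f
      using that by (intro van) auto
    with insert.IH[OF F add smult] show ?thesis
      by blast
  qed
qed

lemma weak_star_continuous_imp_evaluation:
  assumes cont: "continuous_map (weak_star_topology V) euclidean \<phi>"
    and add: "\<And>f g. f \<in> vecs (dual V) \<Longrightarrow> g \<in> vecs (dual V) \<Longrightarrow> \<phi> (f + g) = \<phi> f + \<phi> g"
    and smult: "\<And>c f. f \<in> vecs (dual V) \<Longrightarrow> \<phi> (smult (dual V) c f) = c * \<phi> f"
  shows "\<exists>h\<in>vecs V. \<forall>f\<in>vecs (dual V). \<phi> f = f h"
proof -
  have zero: "0 \<in> vecs (dual V)"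
    using seminormed_carrier.zero_mem[OF seminormed_carrier_dual] .
  have top: "topspace (weak_star_topology V) = vecs (dual V)"
    unfolding weak_star_topology_def using zero_mem by (intro topspace_initial_topology) blast
  have "openin (weak_star_topology V) {f \<in> vecs (dual V). \<phi> f \<in> ball 0 1}"
    using openin_continuous_map_preimage[OF cont, of "ball 0 1"] by (simp add: top)
  moreover have "\<phi> 0 = 0"
    using add[OF zero zero] by simp
  ultimately have "\<exists>F. finite F \<and> F \<subseteq> vecs V
      \<and> {f \<in> vecs (dual V). \<forall>x\<in>F. f x = 0} \<subseteq> {f \<in> vecs (dual V). \<phi> f \<in> ball 0 1}"
    using zero by (intro weak_star_open_contains_annihilator) (simp_all del: mem_ball)
  then obtain F where F: "finite F" "F \<subseteq> vecs V"
    "{f \<in> vecs (dual V). \<forall>x\<in>F. f x = 0} \<subseteq> {f \<in> vecs (dual V). \<phi> f \<in> ball 0 1}"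
    by blast
  have "\<phi> f = 0" if f: "f \<in> vecs (dual V)" "\<forall>x\<in>F. f x = 0" for f
  proof (rule ccontr)
    assume "\<phi> f \<noteq> 0"
    \<comment> \<open>The annihilator is a subspace, so \<open>f\<close> may be rescaled out of the unit ball.\<close>
    let ?g = "smult (dual V) (inverse (\<phi> f)) f"
    have "?g \<in> {f \<in> vecs (dual V). \<forall>x\<in>F. f x = 0}"
      using f dual_smult_mem by (auto simp: smult_dual)
    with F(3) have "norm (\<phi> ?g) < 1"
      by auto
    then show False
      using smult[OF f(1)] \<open>\<phi> f \<noteq> 0\<close> by simp
  qed
  with functional_vanishing_on_annihilator[OF F(1,2) add smult] show ?thesis
    by blast
qed

end


section \<open>The first Arens product\<close>

definition to_bidual ::
  "('k::real_normed_field, 'v::ab_group_add, 'm) normed_sp_scheme \<Rightarrow> 'v \<Rightarrow> (('v \<Rightarrow> 'k) \<Rightarrow> 'k)" where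
  "to_bidual V x = (\<lambda>f. if f \<in> vecs (dual V) then f x else 0)"

lemma (in seminormed_carrier) to_bidual_mem:
  assumes x: "x \<in> vecs V"
  shows "to_bidual V x \<in> vecs (dual (dual V))"
proof (rule dual_memI[where K = "nrm V x"])
  show "to_bidual V x (smult (dual V) c f) = c * to_bidual V x f" if "f \<in> vecs (dual V)" for c f
    using dual_smult_mem[OF that, of c] that by (simp add: to_bidual_def) (simp add: smult_dual)
qed (use norm_le_dual_nrm[OF _ x] in
      \<open>simp_all add: to_bidual_def dual_add_mem mult.commute\<close>)

lemma bidual_alg_simps:
  "vecs (bidual_alg A) = vecs (dual (dual A))"
  "smult (bidual_alg A) = smult (dual (dual A))"
  "nrm (bidual_alg A) = nrm (dual (dual A))"
  "mul (bidual_alg A) = first_arens A"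
  by (simp_all add: bidual_alg_def)

lemma dual_bidual_alg: "dual (bidual_alg A) = dual (dual (dual A))"
  by (simp add: dual_def[of "bidual_alg A"] dual_def[of "dual (dual A)"] bidual_alg_simps)

context banach_algebra_over
begin

abbreviation A :: "('k, 'a) normed_alg" where "A \<equiv> alg_of sc"

lemma alg_of_simps [simp]:
  "vecs A = UNIV" "smult A = sc" "nrm A = norm" "mul A = (*)"
  by (simp_all add: alg_of_def)

sublocale alg: seminormed_carrier A
  by unfold_locales (simp_all add: norm_scale)

sublocale dual: seminormed_carrier "dual A"
  by (rule alg.seminormed_carrier_dual)

sublocale bidual: seminormed_carrier "dual (dual A)"
  by (rule dual.seminormed_carrier_dual)

lemma dual_ract_apply: "dual_ract A f a b = f (a * b)"
  and dual_lact_apply: "dual_lact A a f b = f (b * a)"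
  and bidual_act_apply: "bidual_act A c f a = c (dual_ract A f a)"
  by (simp_all add: dual_ract_def dual_lact_def bidual_act_def)

lemma norm_dual_ract_le:
  assumes "f \<in> vecs (dual A)"
  shows "norm (dual_ract A f a b) \<le> (nrm (dual A) f * norm a) * norm b"
proof -
  have "norm (f (a * b)) \<le> nrm (dual A) f * norm (a * b)"
    using alg.norm_le_dual_nrm[OF assms, of "a * b"] by simp
  also have "\<dots> \<le> nrm (dual A) f * (norm a * norm b)"
    using alg.dual_nrm_nonneg[OF assms] by (intro mult_left_mono norm_mult_ineq)
  finally show ?thesis
    by (simp add: dual_ract_apply mult.assoc)
qed

lemma dual_ract_mem:
  assumes f: "f \<in> vecs (dual A)"
  shows "dual_ract A f a \<in> vecs (dual A)"
  by (rule dual_memI[where K = "nrm (dual A) f * norm a"])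
    (use norm_dual_ract_le[OF f] dual_add[OF f] dual_smult[OF f] in
      \<open>simp_all add: dual_ract_apply distrib_left scale_mult_right\<close>)

lemma nrm_dual_ract_le:
  assumes f: "f \<in> vecs (dual A)"
  shows "nrm (dual A) (dual_ract A f a) \<le> nrm (dual A) f * norm a"
  by (rule alg.dual_nrm_le)
    (use norm_dual_ract_le[OF f] in \<open>simp_all add: alg.dual_nrm_nonneg[OF f]\<close>)

lemma dual_lact_mem:
  assumes f: "f \<in> vecs (dual A)"
  shows "dual_lact A a f \<in> vecs (dual A)"
proof (rule dual_memI[where K = "nrm (dual A) f * norm a"])
  fix b
  have "norm (f (b * a)) \<le> nrm (dual A) f * norm (b * a)"
    using alg.norm_le_dual_nrm[OF f, of "b * a"] by simp
  also have "\<dots> \<le> nrm (dual A) f * (norm b * norm a)"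
    using alg.dual_nrm_nonneg[OF f] by (intro mult_left_mono norm_mult_ineq)
  finally show "norm (dual_lact A a f b) \<le> nrm (dual A) f * norm a * nrm A b"
    by (simp add: dual_lact_apply mult_ac)
qed (use dual_add[OF f] dual_smult[OF f] in
      \<open>simp_all add: dual_lact_apply distrib_right scale_mult_left\<close>)

lemma norm_bidual_act_le:
  assumes c: "c \<in> vecs (dual (dual A))" and f: "f \<in> vecs (dual A)"
  shows "norm (bidual_act A c f a) \<le> (nrm (dual (dual A)) c * nrm (dual A) f) * norm a"
proof -
  have "norm (c (dual_ract A f a)) \<le> nrm (dual (dual A)) c * nrm (dual A) (dual_ract A f a)"
    by (rule dual.norm_le_dual_nrm[OF c dual_ract_mem[OF f]])
  also have "\<dots> \<le> nrm (dual (dual A)) c * (nrm (dual A) f * norm a)"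
    by (intro mult_left_mono nrm_dual_ract_le[OF f] dual.dual_nrm_nonneg[OF c])
  finally show ?thesis
    by (simp add: bidual_act_apply mult.assoc)
qed

lemma dual_ract_add:
  assumes f: "f \<in> vecs (dual A)"
  shows "dual_ract A f (a + b) = dual_ract A f a + dual_ract A f b"
  by (rule ext) (use dual_add[OF f] in \<open>simp add: dual_ract_apply distrib_right\<close>)

lemma dual_ract_scale:
  assumes f: "f \<in> vecs (dual A)"
  shows "dual_ract A f (sc t a) = smult (dual A) t (dual_ract A f a)"
  by (rule ext) (use dual_smult[OF f] in \<open>simp add: dual_ract_apply scale_mult_left smult_dual\<close>)

lemma bidual_act_mem:
  assumes c: "c \<in> vecs (dual (dual A))" and f: "f \<in> vecs (dual A)"
  shows "bidual_act A c f \<in> vecs (dual A)"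
  by (rule dual_memI[where K = "nrm (dual (dual A)) c * nrm (dual A) f"])
    (use norm_bidual_act_le[OF c f] in \<open>simp_all add: bidual_act_apply
       dual_ract_add[OF f] dual_ract_scale[OF f] dual_add[OF c] dual_smult[OF c] dual_ract_mem[OF f]\<close>)

lemma nrm_bidual_act_le:
  assumes c: "c \<in> vecs (dual (dual A))" and f: "f \<in> vecs (dual A)"
  shows "nrm (dual A) (bidual_act A c f) \<le> nrm (dual (dual A)) c * nrm (dual A) f"
  by (rule alg.dual_nrm_le)
    (use norm_bidual_act_le[OF c f] in
      \<open>simp_all add: alg.dual_nrm_nonneg[OF f] dual.dual_nrm_nonneg[OF c]\<close>)

lemma bidual_act_add:
  assumes c: "c \<in> vecs (dual (dual A))" and f: "f \<in> vecs (dual A)" and g: "g \<in> vecs (dual A)"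
  shows "bidual_act A c (f + g) = bidual_act A c f + bidual_act A c g"
proof (rule ext)
  fix x
  have "dual_ract A (f + g) x = dual_ract A f x + dual_ract A g x"
    by (rule ext) (simp add: dual_ract_apply)
  then show "bidual_act A c (f + g) x = (bidual_act A c f + bidual_act A c g) x"
    by (simp add: bidual_act_apply dual_add[OF c] dual_ract_mem f g)
qed

lemma bidual_act_smult:
  assumes c: "c \<in> vecs (dual (dual A))" and f: "f \<in> vecs (dual A)"
  shows "bidual_act A c (smult (dual A) t f) = smult (dual A) t (bidual_act A c f)"
proof (rule ext)
  fix x
  have "dual_ract A (smult (dual A) t f) x = smult (dual A) t (dual_ract A f x)"
    by (rule ext) (simp add: dual_ract_apply smult_dual)
  then have "bidual_act A c (smult (dual A) t f) x = t * c (dual_ract A f x)"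
    by (simp only: bidual_act_apply dual_smult[OF c dual_ract_mem[OF f]])
  then show "bidual_act A c (smult (dual A) t f) x = smult (dual A) t (bidual_act A c f) x"
    by (simp add: bidual_act_apply smult_dual)
qed

lemma first_arens_apply: "f \<in> vecs (dual A) \<Longrightarrow> first_arens A a b f = a (bidual_act A b f)"
  by (simp add: first_arens_def)

lemma first_arens_mem:
  assumes a: "a \<in> vecs (dual (dual A))" and b: "b \<in> vecs (dual (dual A))"
  shows "first_arens A a b \<in> vecs (dual (dual A))"
proof (rule dual_memI[where K = "nrm (dual (dual A)) a * nrm (dual (dual A)) b"])
  fix f assume f: "f \<in> vecs (dual A)"
  have "norm (a (bidual_act A b f)) \<le> nrm (dual (dual A)) a * nrm (dual A) (bidual_act A b f)"
    by (rule dual.norm_le_dual_nrm[OF a bidual_act_mem[OF b f]])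
  also have "\<dots> \<le> nrm (dual (dual A)) a * (nrm (dual (dual A)) b * nrm (dual A) f)"
    by (intro mult_left_mono nrm_bidual_act_le[OF b f] dual.dual_nrm_nonneg[OF a])
  finally show "norm (first_arens A a b f)
      \<le> nrm (dual (dual A)) a * nrm (dual (dual A)) b * nrm (dual A) f"
    by (simp add: first_arens_apply[OF f] mult.assoc)
qed (simp_all add: first_arens_def alg.dual_add_mem alg.dual_smult_mem bidual_act_add[OF b]
       bidual_act_smult[OF b] bidual_act_mem[OF b] dual_add[OF a] dual_smult[OF a])

lemma first_arens_add_right:
  assumes a: "a \<in> vecs (dual (dual A))"
    and b: "b \<in> vecs (dual (dual A))" and c: "c \<in> vecs (dual (dual A))"
  shows "first_arens A a (b + c) = first_arens A a b + first_arens A a c"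
proof (rule ext)
  fix f
  have "bidual_act A (b + c) f = bidual_act A b f + bidual_act A c f"
    by (rule ext) (simp add: bidual_act_apply)
  then show "first_arens A a (b + c) f = (first_arens A a b + first_arens A a c) f"
    by (simp add: first_arens_def dual_add[OF a] bidual_act_mem b c)
qed

lemma first_arens_smult_right:
  assumes a: "a \<in> vecs (dual (dual A))" and b: "b \<in> vecs (dual (dual A))"
  shows "first_arens A a (smult (dual (dual A)) t b) = smult (dual (dual A)) t (first_arens A a b)"
proof (rule ext)
  fix f
  have "bidual_act A (smult (dual (dual A)) t b) f = smult (dual A) t (bidual_act A b f)"
    by (rule ext) (simp add: bidual_act_apply smult_dual)
  moreover have "a (smult (dual A) t (bidual_act A b f)) = t * a (bidual_act A b f)"
    if "f \<in> vecs (dual A)"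
    using that by (intro dual_smult[OF a] bidual_act_mem b)
  ultimately show "first_arens A a (smult (dual (dual A)) t b) f
      = smult (dual (dual A)) t (first_arens A a b) f"
    by (simp add: first_arens_def smult_dual[of "dual A"])
qed

lemma first_arens_to_bidual_left:
  assumes b: "b \<in> vecs (dual (dual A))" and f: "f \<in> vecs (dual A)"
  shows "first_arens A (to_bidual A x) b f = b (dual_ract A f x)"
  using bidual_act_mem[OF b f] by (simp add: first_arens_apply[OF f] to_bidual_def bidual_act_apply)

lemma first_arens_to_bidual_right:
  assumes f: "f \<in> vecs (dual A)"
  shows "first_arens A a (to_bidual A x) f = a (dual_lact A x f)"
proof -
  have "bidual_act A (to_bidual A x) f = dual_lact A x f"
    by (rule ext)
      (simp add: bidual_act_apply to_bidual_def dual_ract_mem[OF f] dual_ract_apply dual_lact_apply)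
  then show ?thesis
    by (simp add: first_arens_apply[OF f])
qed

lemma first_arens_to_bidual: "first_arens A (to_bidual A x) (to_bidual A y) = to_bidual A (x * y)"
proof (rule ext)
  fix f
  show "first_arens A (to_bidual A x) (to_bidual A y) f = to_bidual A (x * y) f"
  proof (cases "f \<in> vecs (dual A)")
    case True
    then show ?thesis
      by (simp add: first_arens_to_bidual_right) (simp add: dual_lact_mem to_bidual_def dual_lact_apply)
  next
    case False
    then show ?thesis
      by (simp add: first_arens_def to_bidual_def)
  qed
qed

text \<open>
  The map applies an element of \<open>A***\<close> after \<open>b \<mapsto> a b\<close>, so it is continuous from the weak* topology
  to the scalars because \<open>b \<mapsto> a b\<close> is weak*-to-weak continuous.
\<close>

lemma I_wsw_property_imp_evaluation:
  assumes wsw: "I_wsw_property A"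
    and g: "g \<in> vecs (dual (dual (dual A)))" and a: "a \<in> vecs (dual (dual A))"
  shows "\<exists>h\<in>vecs (dual A). \<forall>b\<in>vecs (dual (dual A)). g (first_arens A a b) = b h"
proof (rule dual.weak_star_continuous_imp_evaluation)
  have "continuous_map (weak_star_topology (dual A)) (weak_topology (bidual_alg A)) (first_arens A a)"
    using wsw a by (simp add: I_wsw_property_def bidual_alg_simps)
  moreover have "continuous_map (weak_topology (bidual_alg A)) euclidean g"
    unfolding weak_topology_def dual_bidual_alg by (rule continuous_map_initial_topology[OF g])
  ultimately have "continuous_map (weak_star_topology (dual A)) euclidean (g \<circ> first_arens A a)"
    by (rule continuous_map_compose)
  then show "continuous_map (weak_star_topology (dual A)) euclidean (\<lambda>b. g (first_arens A a b))"
    by (simp add: comp_def)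
  show "g (first_arens A a (b + c)) = g (first_arens A a b) + g (first_arens A a c)"
    if "b \<in> vecs (dual (dual A))" "c \<in> vecs (dual (dual A))" for b c
    using that by (simp add: first_arens_add_right[OF a] dual_add[OF g] first_arens_mem[OF a])
  show "g (first_arens A a (smult (dual (dual A)) t b)) = t * g (first_arens A a b)"
    if "b \<in> vecs (dual (dual A))" for t b
    using that dual_smult[OF g first_arens_mem[OF a]]
    by (simp add: first_arens_smult_right[OF a])
qed

end


section \<open>The second adjoint of a derivation\<close>

definition adjoint_map :: "('v \<Rightarrow> 'w) \<Rightarrow> ('w \<Rightarrow> 'k) \<Rightarrow> ('v \<Rightarrow> 'k)" where
  "adjoint_map T c = (\<lambda>x. c (T x))"

text \<open>
  For \<open>T : V \<rightarrow> V*\<close> the second adjoint maps \<open>V**\<close> to \<open>V***\<close>; as a functional on \<open>V**\<close> it has to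
  vanish outside.
\<close>

definition second_adjoint ::
  "('k::real_normed_field, 'v::ab_group_add, 'm) normed_sp_scheme
    \<Rightarrow> ('v \<Rightarrow> ('v \<Rightarrow> 'k)) \<Rightarrow> (('v \<Rightarrow> 'k) \<Rightarrow> 'k) \<Rightarrow> ((('v \<Rightarrow> 'k) \<Rightarrow> 'k) \<Rightarrow> 'k)" where
  "second_adjoint V T a = (\<lambda>c. if c \<in> vecs (dual (dual V)) then a (adjoint_map T c) else 0)"

locale algebra_derivation = banach_algebra_over sc
  for sc :: "'k::real_normed_field \<Rightarrow> 'a::{real_normed_algebra, banach} \<Rightarrow> 'a" +
  fixes D :: "'a \<Rightarrow> ('a \<Rightarrow> 'k)"
  assumes derivation: "derivation (alg_of sc) D"
begin

lemma D_mem: "D x \<in> vecs (dual A)"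
  and D_add: "D (x + y) = D x + D y"
  and D_scale: "D (sc c x) = smult (dual A) c (D x)"
  and D_mult: "D (x * y) = dual_lact A x (D y) + dual_ract A (D x) y"
  using derivation by (auto simp: derivation_def)

lemma D_bounded: obtains K where "0 \<le> K" "\<And>x. nrm (dual A) (D x) \<le> K * norm x"
proof -
  obtain K where K: "\<And>x. nrm (dual A) (D x) \<le> K * norm x"
    using derivation by (auto simp: derivation_def)
  have "K * norm x \<le> \<bar>K\<bar> * norm x" for x :: 'a
    by (intro mult_right_mono) auto
  then have "nrm (dual A) (D x) \<le> \<bar>K\<bar> * norm x" for x
    using K order_trans by blast
  then show thesis
    using that[of "\<bar>K\<bar>"] by simp
qed

lemma adjoint_bounded:
  assumes K: "0 \<le> K" "\<And>x. nrm (dual A) (D x) \<le> K * norm x" and c: "c \<in> vecs (dual (dual A))"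
  shows "norm (adjoint_map D c x) \<le> (nrm (dual (dual A)) c * K) * norm x"
proof -
  have "norm (c (D x)) \<le> nrm (dual (dual A)) c * nrm (dual A) (D x)"
    by (rule dual.norm_le_dual_nrm[OF c D_mem])
  also have "\<dots> \<le> nrm (dual (dual A)) c * (K * norm x)"
    by (intro mult_left_mono K dual.dual_nrm_nonneg[OF c])
  finally show ?thesis
    by (simp add: adjoint_map_def mult.assoc)
qed

lemma adjoint_mem:
  assumes c: "c \<in> vecs (dual (dual A))"
  shows "adjoint_map D c \<in> vecs (dual A)"
proof -
  obtain K where "0 \<le> K" "\<And>x. nrm (dual A) (D x) \<le> K * norm x"
    using D_bounded by blast
  note adjoint_bounded[OF this c]
  then show ?thesis
    by (intro dual_memI[where K = "nrm (dual (dual A)) c * K"])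
      (simp_all add: adjoint_map_def D_add D_scale dual_add[OF c] dual_smult[OF c] D_mem)
qed

lemma second_adjoint_apply:
  "c \<in> vecs (dual (dual A)) \<Longrightarrow> second_adjoint A D a c = a (adjoint_map D c)"
  by (simp add: second_adjoint_def)

lemma norm_second_adjoint_le:
  assumes K: "0 \<le> K" "\<And>x. nrm (dual A) (D x) \<le> K * norm x"
    and a: "a \<in> vecs (dual (dual A))" and c: "c \<in> vecs (dual (dual A))"
  shows "norm (second_adjoint A D a c) \<le> (K * nrm (dual (dual A)) a) * nrm (dual (dual A)) c"
proof -
  have "nrm (dual A) (adjoint_map D c) \<le> nrm (dual (dual A)) c * K"
    by (rule alg.dual_nrm_le)
      (use adjoint_bounded[OF K c] in \<open>simp_all add: K dual.dual_nrm_nonneg[OF c]\<close>)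
  then have "nrm (dual (dual A)) a * nrm (dual A) (adjoint_map D c)
      \<le> nrm (dual (dual A)) a * (nrm (dual (dual A)) c * K)"
    by (intro mult_left_mono dual.dual_nrm_nonneg[OF a])
  then show ?thesis
    using dual.norm_le_dual_nrm[OF a adjoint_mem[OF c]]
    by (simp add: second_adjoint_apply[OF c] mult_ac)
qed

lemma second_adjoint_mem:
  assumes a: "a \<in> vecs (dual (dual A))"
  shows "second_adjoint A D a \<in> vecs (dual (dual (dual A)))"
proof -
  obtain K where "0 \<le> K" "\<And>x. nrm (dual A) (D x) \<le> K * norm x"
    using D_bounded by blast
  note bound = norm_second_adjoint_le[OF this a]
  have "adjoint_map D (c + d) = adjoint_map D c + adjoint_map D d" for c d :: "('a \<Rightarrow> 'k) \<Rightarrow> 'k"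
    by (rule ext) (simp add: adjoint_map_def)
  moreover have "adjoint_map D (smult (dual (dual A)) t c) = smult (dual A) t (adjoint_map D c)" for t c
    by (rule ext) (simp add: adjoint_map_def smult_dual)
  ultimately show ?thesis
    by (intro dual_memI[OF _ _ _ bound])
      (simp_all add: second_adjoint_def dual.dual_add_mem dual.dual_smult_mem
        dual_add[OF a] dual_smult[OF a] adjoint_mem)
qed

lemma second_adjoint_to_bidual: "second_adjoint A D (to_bidual A x) (to_bidual A y) = D x y"
  using adjoint_mem[OF alg.to_bidual_mem[of y]] alg.to_bidual_mem[of y] D_mem[of x]
  by (simp add: second_adjoint_apply to_bidual_def[of _ x]) (simp add: adjoint_map_def to_bidual_def)

text \<open>For \<open>x \<in> A\<close> every term is \<open>b\<close> evaluated at an element of \<open>A*\<close>.\<close>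

lemma second_adjoint_mult_to_bidual:
  assumes b: "b \<in> vecs (dual (dual A))" and c: "c \<in> vecs (dual (dual A))"
  shows "second_adjoint A D (first_arens A (to_bidual A x) b) c =
    second_adjoint A D b (first_arens A c (to_bidual A x)) +
    second_adjoint A D (to_bidual A x) (first_arens A b c)"
proof -
  have x: "to_bidual A x \<in> vecs (dual (dual A))"
    by (simp add: alg.to_bidual_mem)
  have cx: "first_arens A c (to_bidual A x) \<in> vecs (dual (dual A))"
    and bc: "first_arens A b c \<in> vecs (dual (dual A))"
    using b c x by (simp_all add: first_arens_mem)
  have eq: "dual_ract A (adjoint_map D c) x = adjoint_map D (first_arens A c (to_bidual A x)) + bidual_act A c (D x)"
  proof (rule ext)
    fix y
    have "c (D (x * y)) = c (dual_lact A x (D y)) + c (dual_ract A (D x) y)"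
      unfolding D_mult by (intro dual_add[OF c] dual_lact_mem dual_ract_mem D_mem)
    then show "dual_ract A (adjoint_map D c) x y
        = (adjoint_map D (first_arens A c (to_bidual A x)) + bidual_act A c (D x)) y"
      by (simp add: dual_ract_apply[of _ x] adjoint_map_def first_arens_to_bidual_right[OF D_mem]
          bidual_act_apply)
  qed
  have "second_adjoint A D (first_arens A (to_bidual A x) b) c = b (dual_ract A (adjoint_map D c) x)"
    by (simp add: second_adjoint_apply[OF c] first_arens_to_bidual_left[OF b adjoint_mem[OF c]])
  also have "\<dots> = b (adjoint_map D (first_arens A c (to_bidual A x))) + b (bidual_act A c (D x))"
    unfolding eq by (intro dual_add[OF b] adjoint_mem cx bidual_act_mem c D_mem)
  also have "b (adjoint_map D (first_arens A c (to_bidual A x)))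
      = second_adjoint A D b (first_arens A c (to_bidual A x))"
    by (simp add: second_adjoint_apply[OF cx])
  also have "b (bidual_act A c (D x)) = second_adjoint A D (to_bidual A x) (first_arens A b c)"
    using adjoint_mem[OF bc]
    by (simp add: second_adjoint_apply[OF bc] to_bidual_def adjoint_map_def first_arens_apply[OF D_mem])
  finally show ?thesis .
qed

text \<open>
  Both sides are evaluations of \<open>a\<close> at elements of \<open>A*\<close>, which are compared on \<open>A\<close>.
\<close>

lemma second_adjoint_mult:
  assumes wsw: "I_wsw_property A"
    and a: "a \<in> vecs (dual (dual A))" and b: "b \<in> vecs (dual (dual A))"
    and c: "c \<in> vecs (dual (dual A))"
  shows "second_adjoint A D (first_arens A a b) c =
    second_adjoint A D b (first_arens A c a) + second_adjoint A D a (first_arens A b c)"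
proof -
  obtain h where h: "h \<in> vecs (dual A)"
    and h_eq: "\<And>a. a \<in> vecs (dual (dual A)) \<Longrightarrow> second_adjoint A D b (first_arens A c a) = a h"
    using I_wsw_property_imp_evaluation[OF wsw second_adjoint_mem[OF b] c] by blast
  define k where "k = bidual_act A b (adjoint_map D c)"
  define l where "l = adjoint_map D (first_arens A b c)"
  have bc: "first_arens A b c \<in> vecs (dual (dual A))"
    by (rule first_arens_mem[OF b c])
  have k: "k \<in> vecs (dual A)" and l: "l \<in> vecs (dual A)"
    by (simp_all add: k_def l_def bidual_act_mem[OF b] adjoint_mem c bc)
  have k_eq: "second_adjoint A D (first_arens A a b) c = a k" for a
    by (simp add: second_adjoint_apply[OF c] first_arens_apply[OF adjoint_mem[OF c]] k_def)
  have l_eq: "second_adjoint A D a (first_arens A b c) = a l" for a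
    by (simp add: second_adjoint_apply[OF bc] l_def)
  have "k = h + l"
  proof (rule ext)
    fix x
    have "to_bidual A x k = to_bidual A x h + to_bidual A x l"
      using second_adjoint_mult_to_bidual[OF b c, of x] h_eq[OF alg.to_bidual_mem] by (simp add: k_eq l_eq)
    then show "k x = (h + l) x"
      by (simp add: to_bidual_def h k l)
  qed
  then have "a k = a h + a l"
    using dual_add[OF a h l] by simp
  then show ?thesis
    by (simp add: k_eq l_eq h_eq[OF a])
qed

text \<open>Off the carrier both sides of the derivation rule vanish.\<close>

lemma second_adjoint_first_arens:
  assumes wsw: "I_wsw_property A"
    and a: "a \<in> vecs (dual (dual A))" and b: "b \<in> vecs (dual (dual A))"
  shows "second_adjoint A D (first_arens A a b) =
    dual_lact (bidual_alg A) a (second_adjoint A D b) +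
    dual_ract (bidual_alg A) (second_adjoint A D a) b"
proof (rule ext)
  fix c
  show "second_adjoint A D (first_arens A a b) c =
    (dual_lact (bidual_alg A) a (second_adjoint A D b) +
    dual_ract (bidual_alg A) (second_adjoint A D a) b) c"
  proof (cases "c \<in> vecs (dual (dual A))")
    case True
    then show ?thesis
      by (simp add: second_adjoint_mult[OF wsw a b] dual_lact_def dual_ract_def bidual_alg_simps)
  next
    case False
    then show ?thesis
      by (simp add: dual_lact_def dual_ract_def bidual_alg_simps second_adjoint_def)
  qed
qed

lemma derivation_second_adjoint:
  assumes wsw: "I_wsw_property A"
  shows "derivation (bidual_alg A) (second_adjoint A D)"
proof -
  have add: "second_adjoint A D (a + b) = second_adjoint A D a + second_adjoint A D b" for a b
    by (rule ext) (simp add: second_adjoint_def)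
  have smult: "second_adjoint A D (smult (dual (dual A)) t a)
      = smult (dual (dual (dual A))) t (second_adjoint A D a)" for t a
    by (rule ext) (simp add: second_adjoint_def smult_dual)
  obtain K where K: "0 \<le> K" "\<And>x. nrm (dual A) (D x) \<le> K * norm x"
    using D_bounded by blast
  have "nrm (dual (dual (dual A))) (second_adjoint A D a) \<le> K * nrm (dual (dual A)) a"
    if a: "a \<in> vecs (dual (dual A))" for a
    by (rule bidual.dual_nrm_le)
      (use norm_second_adjoint_le[OF K a] in \<open>simp_all add: K(1) dual.dual_nrm_nonneg[OF a]\<close>)
  then have bounded: "\<exists>K. \<forall>a\<in>vecs (dual (dual A)).
      nrm (dual (dual (dual A))) (second_adjoint A D a) \<le> K * nrm (dual (dual A)) a"
    by blast
  show ?thesis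
    unfolding derivation_def bidual_alg_simps dual_bidual_alg
    by (intro conjI ballI allI second_adjoint_mem add smult bounded
        second_adjoint_first_arens[OF wsw])
qed

lemma inner_if_second_adjoint_inner:
  assumes "inner_derivation (bidual_alg A) (second_adjoint A D)"
  shows "inner_derivation A D"
proof -
  obtain g where g: "g \<in> vecs (dual (dual (dual A)))"
    and g_eq: "\<And>a. a \<in> vecs (dual (dual A)) \<Longrightarrow>
      second_adjoint A D a = dual_lact (bidual_alg A) a g - dual_ract (bidual_alg A) g a"
    using assms by (auto simp: inner_derivation_def bidual_alg_simps dual_bidual_alg)
  define f where "f = adjoint_map (to_bidual A) g"
  have to_bidual: "to_bidual A x \<in> vecs (dual (dual A))" for x
    by (simp add: alg.to_bidual_mem)
  have "f \<in> vecs (dual A)"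
  proof (rule dual_memI[where K = "nrm (dual (dual (dual A))) g"])
    fix x y t
    have "to_bidual A (x + y) = to_bidual A x + to_bidual A y"
      by (rule ext) (simp add: to_bidual_def dual_add)
    then show "f (x + y) = f x + f y"
      by (simp add: f_def adjoint_map_def dual_add[OF g] to_bidual)
    have "to_bidual A (sc t x) = smult (dual (dual A)) t (to_bidual A x)"
      using dual_smult[of _ A x t] by (intro ext) (simp add: to_bidual_def smult_dual)
    then show "f (smult A t x) = t * f x"
      by (simp add: f_def adjoint_map_def dual_smult[OF g] to_bidual)
    have "nrm (dual (dual A)) (to_bidual A x) \<le> norm x"
      by (rule dual.dual_nrm_le)
        (use alg.norm_le_dual_nrm[of _ x] in \<open>auto simp: to_bidual_def mult.commute\<close>)
    then have "nrm (dual (dual (dual A))) g * nrm (dual (dual A)) (to_bidual A x)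
        \<le> nrm (dual (dual (dual A))) g * norm x"
      by (intro mult_left_mono bidual.dual_nrm_nonneg[OF g])
    then show "norm (f x) \<le> nrm (dual (dual (dual A))) g * nrm A x"
      using bidual.norm_le_dual_nrm[OF g to_bidual[of x]] by (simp add: f_def adjoint_map_def)
  qed simp
  moreover have "D x = dual_lact A x f - dual_ract A f x" for x
  proof (rule ext)
    fix y
    have "D x y = g (first_arens A (to_bidual A y) (to_bidual A x)) - g (first_arens A (to_bidual A x) (to_bidual A y))"
      using g_eq[OF to_bidual[of x]] to_bidual[of y]
      by (simp flip: second_adjoint_to_bidual add: dual_lact_def dual_ract_def bidual_alg_simps)
    then show "D x y = (dual_lact A x f - dual_ract A f x) y"
      by (simp add: first_arens_to_bidual dual_lact_apply dual_ract_apply f_def adjoint_map_def)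
  qed
  ultimately show ?thesis
    by (auto simp: inner_derivation_def)
qed

end


section \<open>Weak amenability descends from the bidual\<close>

theorem mainTheorem6:
  fixes sc :: "'k::real_normed_field \<Rightarrow> 'a::{real_normed_algebra, banach} \<Rightarrow> 'a"
  assumes "banach_algebra_over sc"
    and "I_wsw_property (alg_of sc)"
    and "weakly_amenable (bidual_alg (alg_of sc))"
  shows "weakly_amenable (alg_of sc)"
  unfolding weakly_amenable_def
proof (intro allI impI)
  fix D
  assume "derivation (alg_of sc) D"
  with assms(1) interpret algebra_derivation sc D
    by (simp add: algebra_derivation_def algebra_derivation_axioms_def)
  have "inner_derivation (bidual_alg (alg_of sc)) (second_adjoint (alg_of sc) D)"
    using assms(3) derivation_second_adjoint[OF assms(2)] by (simp add: weakly_amenable_def)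
  then show "inner_derivation (alg_of sc) D"
    by (rule inner_if_second_adjoint_inner)
qed

end
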